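(* Let $j\ge2$ be an integer and let $S_j=[p_j+1,\;p_j^2+4p_j+3]\setminus\mathbb{C}([p_j+1,\;p_j^2+4p_j+3])$. Then: (a) $S_j$ is non-empty; (b) $S_j$ contains prime number(s) as its element(s); (c) $S_j=\varphi([p_j+1,\;p_j^2+4p_j+3])=\varphi([p_j+2,\;p_j^2+4p_j+2])$; (d) $S_j=[p_j+2,\;p_j^2+4p_j+2]\setminus\Big(\bigcup_{i=1}^{j}p_i\{Q_{i,j}+1,Q_{i,j}+2,\ldots,Q'''_{i,j}\}\Big)$, where $Q_{i,j}=\left\lfloor\frac{p_j}{p_i}\right\rfloor$ and $Q'''_{i,j}=\left\lfloor\frac{p_j^2+4p_j+2}{p_i}\right\rfloor$ for $1\le i\le j$.
   Context: $\mathbb{N}=\{1,2,\ldots\}$. For $m\le n$ in $\mathbb{N}$, $[m,n]=\{k\in\mathbb{N}: m\le k\le n\}$. $p_1=2,p_2=3,\ldots$ are the primes in increasing order. For $S\subseteq\mathbb{N}$, $\varphi(S)$ is the set of all primes in $S$ and $\mathbb{C}(S)$ is the set of all composite numbers in $S$. For an integer $a$ and a set $T$ of integers, $aT=\{at:t\in T\}$. *)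

theory Defs
  imports Complex_Main "HOL-Computational_Algebra.Primes" "HOL-Library.Infinite_Set"
begin

text \<open>
  The source takes the natural numbers to start at 1 and indexes the primes from 1, so
  \<open>nth_prime 1 = 2\<close>, \<open>nth_prime 2 = 3\<close>, and so on, whereas \<^const>\<open>enumerate\<close>
  counts from 0. The value at index 0 is junk (it equals \<open>nth_prime 1\<close>).
\<close>
definition nth_prime :: "nat \<Rightarrow> nat" where
  "nth_prime i = enumerate {p::nat. prime p} (i - 1)"

definition primes_in :: "nat set \<Rightarrow> nat set" where
  "primes_in S = {n \<in> S. prime n}"

text \<open>The number 1 is neither prime nor composite.\<close>
definition composites_in :: "nat set \<Rightarrow> nat set" where
  "composites_in S = {n \<in> S. 1 < n \<and> \<not> prime n}"

definition S_set :: "nat \<Rightarrow> nat set" where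
  "S_set j =
    {nth_prime j + 1 .. (nth_prime j)\<^sup>2 + 4 * nth_prime j + 3}
      - composites_in {nth_prime j + 1 .. (nth_prime j)\<^sup>2 + 4 * nth_prime j + 3}"

definition Q :: "nat \<Rightarrow> nat \<Rightarrow> nat" where
  "Q i j = nat \<lfloor>real (nth_prime j) / real (nth_prime i)\<rfloor>"

definition Q''' :: "nat \<Rightarrow> nat \<Rightarrow> nat" where
  "Q''' i j =
    nat \<lfloor>real ((nth_prime j)\<^sup>2 + 4 * nth_prime j + 2) / real (nth_prime i)\<rfloor>"

end

theory Submission
  imports Defs
begin

text \<open>
  Write \<open>p\<close> for the \<open>j\<close>-th prime, an odd number. Both \<open>p + 1\<close> and
  \<open>p\<^sup>2 + 4p + 3 = (p + 1)(p + 3)\<close> are composite, and a composite number below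
  \<open>(p + 2)\<^sup>2\<close> has a prime factor at most \<open>p + 1\<close>, hence at most \<open>p\<close>; this gives
  the descriptions of the set. A prime in the interval comes from Nair's bound
  \<open>2\<^sup>n\<^sup>-\<^sup>1 \<le> lcm(1, \<dots>, n)\<close>: if every prime up to \<open>n = p\<^sup>2 + 4p + 2\<close> were at most \<open>p\<close>,
  the least common multiple would be at most \<open>n\<^sup>p\<^sup>-\<^sup>1\<close>, which is too small.
\<close>

text \<open>Induction on \<open>k\<close> with \<open>n\<close> free: the claims for
  \<open>k\<close> at \<open>n\<close> and at \<open>n - 1\<close> give cofactors \<open>u\<close>
  and \<open>v\<close> of the lcm, and their difference \<open>v - u\<close> is the cofactor for
  \<open>Suc k\<close>.\<close>

lemma mult_binomial_dvd_Lcm: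
  assumes "1 \<le> k" "k \<le> n"
  shows "k * (n choose k) dvd Lcm {1..n}"
  using assms
proof (induction k arbitrary: n rule: dec_induct)
  case base
  then show ?case by (auto intro: dvd_Lcm)
next
  case (step k)
  define a b c where "a = k * (n choose k)" and "b = k * ((n - 1) choose k)"
    and "c = Suc k * (n choose Suc k)"
  obtain m where m: "n = Suc m" "k \<le> m"
    using step.prems by (cases n) auto
  have "a dvd Lcm {1..n}"
    unfolding a_def using step by simp
  then obtain u where u: "Lcm {1..n} = a * u" by blast
  have "b dvd Lcm {1..n - 1}"
    unfolding b_def using step m by simp
  also have "Lcm {1..n - 1} dvd Lcm {1..n}"
    by (rule Lcm_subset) auto
  finally obtain v where v: "Lcm {1..n} = b * v" by blast
  \<comment> \<open>Two absorption identities yield \<open>k * c = n * b = (n - k) * a\<close>,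
    which is the relation between the three reciprocals with denominators cleared.\<close>
  have c: "c = n * ((n - 1) choose k)"
    unfolding c_def m by (simp only: Suc_times_binomial diff_Suc_1)
  have a: "(n - k) * a = n * b"
  proof -
    have "(n - k) * (n choose k) = n * ((n - 1) choose k)"
      using m by (metis binomial_absorb_comp)
    then show ?thesis
      unfolding a_def b_def by (metis mult.left_commute)
  qed
  have kc: "int k * int c = int n * int b"
    unfolding c b_def by simp
  text \<open>Leibniz's harmonic triangle: \<open>1/c = 1/b - 1/a\<close>.\<close>
  have "int (Lcm {1..n}) = int c * (int v - int u)"
  proof -
    let ?L = "int (Lcm {1..n})"
    have "int n * int b = (int n - int k) * int a"
      using arg_cong[OF a, of int] step.prems by simp
    then have "int n * int b * int u = (int n - int k) * int a * int u" by simp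
    also have "\<dots> = (int n - int k) * ?L" by (simp only: u of_nat_mult mult.assoc)
    finally have nbu: "int n * int b * int u = (int n - int k) * ?L" .
    have nbv: "int n * int b * int v = int n * ?L" by (simp only: v of_nat_mult mult.assoc)
    \<comment> \<open>The claim is shown after multiplication by \<open>k\<close>, which is positive
      and cancels.\<close>
    have "int k * (int c * (int v - int u)) = int n * int b * (int v - int u)"
      by (simp only: kc mult.assoc[symmetric])
    also have "\<dots> = int n * ?L - (int n - int k) * ?L"
      by (simp only: right_diff_distrib[of "int n * int b"] nbu nbv)
    also have "\<dots> = int k * ?L" by (simp add: algebra_simps)
    finally show ?thesis using step.hyps by simp
  qed
  then have "int c dvd int (Lcm {1..n})" by simp
  then show ?case by (simp only: c_def int_dvd_int_iff)
qed

text \<open>The \<open>n\<close> numbers \<open>k * (n choose k)\<close> with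
  \<open>1 \<le> k \<le> n\<close> sum to \<open>n * 2 ^ (n - 1)\<close>. Each divides the lcm, so
  the lcm is at least their average.\<close>

lemma Lcm_atLeastAtMost_ge: "2 ^ (n - 1) \<le> Lcm {1..n::nat}"
proof (cases "n = 0")
  case False
  have L: "Lcm {1..n} > 0"
    by (metis Lcm_0_iff_nat atLeastAtMost_iff finite_atLeastAtMost gr0I not_one_le_zero)
  have "n * 2 ^ (n - 1) = (\<Sum>k\<le>n. k * (n choose k))"
    by (simp add: choose_linear_sum)
  also have "\<dots> = (\<Sum>k\<in>{1..n}. k * (n choose k))"
    by (rule sum.mono_neutral_right) (auto simp: not_less_eq_eq)
  also have "\<dots> \<le> (\<Sum>k\<in>{1..n}. Lcm {1..n})"
    by (intro sum_mono dvd_imp_le[OF mult_binomial_dvd_Lcm L]) simp_all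
  finally show ?thesis using False by simp
qed simp

text \<open>Each prime up to \<open>n\<close> enters the lcm with a power that divides some number
  in \<open>{1..n}\<close>, so this power is at most \<open>n\<close>.\<close>

lemma Lcm_atLeastAtMost_le: "Lcm {1..n} \<le> n ^ card {q. prime q \<and> q \<le> n}" for n :: nat
proof (cases "n = 0")
  case False
  define P where "P = {q. prime q \<and> q \<le> n}"
  define e where "e q = Max ((\<lambda>m. multiplicity q m) ` {1..n})" for q :: nat
  have fin: "finite P" unfolding P_def by simp
  have le: "q ^ e q \<le> n" for q
  proof -
    have "e q \<in> (\<lambda>m. multiplicity q m) ` {1..n}"
      unfolding e_def using False by (intro Max_in) auto
    then obtain m where m: "m \<in> {1..n}" "e q = multiplicity q m" by blast
    then have "q ^ e q \<le> m" by (intro dvd_imp_le) (auto simp: multiplicity_dvd)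
    with m show ?thesis by simp
  qed
  have "m dvd (\<Prod>q\<in>P. q ^ e q)" if m: "m \<in> {1..n}" for m
  proof -
    have "m = (\<Prod>q\<in>prime_factors m. q ^ multiplicity q m)"
      using m by (intro prime_factorization_nat) auto
    also have "\<dots> dvd (\<Prod>q\<in>prime_factors m. q ^ e q)"
      using m by (intro prod_dvd_prod le_imp_power_dvd) (auto simp: e_def intro!: Max_ge)
    also have "\<dots> dvd (\<Prod>q\<in>P. q ^ e q)"
      using m fin by (intro prod_dvd_prod_subset)
        (auto simp: P_def prime_factors_dvd dest: dvd_imp_le)
    finally show ?thesis .
  qed
  then have "Lcm {1..n} dvd (\<Prod>q\<in>P. q ^ e q)" by (rule Lcm_least)
  moreover have "(\<Prod>q\<in>P. q ^ e q) > 0"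
    by (intro prod_pos) (auto simp: P_def prime_gt_0_nat)
  ultimately have "Lcm {1..n} \<le> (\<Prod>q\<in>P. q ^ e q)" by (rule dvd_imp_le)
  also have "\<dots> \<le> (\<Prod>q\<in>P. n)" by (intro prod_mono) (auto simp: le)
  finally show ?thesis by (simp add: P_def)
\<comment> \<open>For \<open>n = 0\<close> the range is empty and both sides are 1, the right one as
  \<open>0 ^ 0\<close>.\<close>
qed (simp cong: conj_cong)

lemma exists_prime_between:
  fixes m :: nat
  assumes "m \<ge> 2"
  shows "\<exists>q. prime q \<and> m < q \<and> q \<le> m\<^sup>2 + 4 * m + 2"
proof (rule ccontr)
  assume none: "\<not> ?thesis"
  define n where "n = m\<^sup>2 + 4 * m + 2"
  have "{q. prime q \<and> q \<le> n} \<subseteq> {2..m}"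
    using none by (auto simp: n_def prime_ge_2_nat not_less)
  then have "card {q. prime q \<and> q \<le> n} \<le> card {2..m}"
    by (rule card_mono[OF finite_atLeastAtMost])
  then have card: "card {q. prime q \<and> q \<le> n} \<le> m - 1" by simp
  \<comment> \<open>Since \<open>n < (m + 2)\<^sup>2\<close>, this turns the upper bound into a
    power of 2, so that exponents can be compared. Equality holds at \<open>m = 2\<close>.\<close>
  have sq: "(m + 2)\<^sup>2 \<le> 2 ^ (m + 2)"
    using assms
  proof (induction m rule: dec_induct)
    case (step k)
    have "(Suc k + 2)\<^sup>2 \<le> 2 * (k + 2)\<^sup>2"
      using step.hyps by (simp add: power2_eq_square algebra_simps)
    with step.IH show ?case by simp
  qed simp
  have "2 ^ (n - 1) \<le> n ^ card {q. prime q \<and> q \<le> n}"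
    using Lcm_atLeastAtMost_ge Lcm_atLeastAtMost_le by (rule order_trans)
  also have "\<dots> \<le> n ^ (m - 1)"
    using card by (intro power_increasing) (auto simp: n_def)
  also have "\<dots> \<le> (2 ^ (m + 2)) ^ (m - 1)"
    using sq by (intro power_mono) (auto simp: n_def power2_eq_square algebra_simps)
  also have "\<dots> = 2 ^ ((m + 2) * (m - 1))" by (rule power_mult[symmetric])
  finally have "n - 1 \<le> (m + 2) * (m - 1)" by simp
  \<comment> \<open>The contradiction comes from
    \<open>n - 1 = (m + 2) * m + 2 * m + 1\<close>.\<close>
  also have "\<dots> \<le> (m + 2) * m" by (rule mult_le_mono2) simp
  finally show False using assms by (simp add: n_def power2_eq_square algebra_simps)
qed

lemma prime_nth_prime: "prime (nth_prime i)"
  using enumerate_in_set[OF primes_infinite] by (auto simp: nth_prime_def)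

lemma nth_prime_ge_3:
  assumes "j \<ge> 2"
  shows "nth_prime j \<ge> 3"
proof -
  have "nth_prime 1 < nth_prime j"
    unfolding nth_prime_def using assms by (intro enumerate_mono primes_infinite) auto
  then show ?thesis using prime_ge_2_nat[OF prime_nth_prime[of 1]] by simp
qed

lemma nth_prime_le_mono:
  assumes "i \<le> j"
  shows "nth_prime i \<le> nth_prime j"
  unfolding nth_prime_def using assms by (auto simp: enumerate_mono_le_iff primes_infinite)

lemma prime_le_nth_primeE:
  assumes "prime q" "q \<le> nth_prime j" "j \<ge> 1"
  obtains i where "i \<in> {1..j}" "q = nth_prime i"
proof -
  obtain r where r: "q = enumerate {p::nat. prime p} r"
    using enumerate_Ex[OF primes_infinite, of q] assms(1) by auto
  then have "r \<le> j - 1"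
    using assms by (simp add: nth_prime_def enumerate_mono_le_iff primes_infinite)
  \<comment> \<open>\<open>enumerate\<close> counts from 0, so position \<open>r\<close> is index
    \<open>Suc r\<close>.\<close>
  with r assms that[of "Suc r"] show thesis by (simp add: nth_prime_def)
qed

lemma not_prime_mult_nat:
  fixes a b :: nat
  assumes "1 < a" "1 < b"
  shows "\<not> prime (a * b)"
  using assms prime_product[of a b] by auto

text \<open>Any prime factor of the smaller of two nontrivial cofactors will do.\<close>

lemma composite_prime_factor_square_le:
  fixes n :: nat
  assumes "1 < n" "\<not> prime n"
  obtains q where "prime q" "q dvd n" "q\<^sup>2 \<le> n"
proof -
  obtain a b where ab: "n = a * b" "1 < a" "1 < b" "a \<le> b"
  proof -
    obtain a where a: "a dvd n" "a \<noteq> 1" "a \<noteq> n"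
      using assms by (auto simp: prime_nat_iff)
    then obtain b where b: "n = a * b" by blast
    have "1 < a" "1 < b" using a b assms by (auto simp: nat_neq_iff)
    then show thesis
      using that[of a b] that[of b a] b by (cases "a \<le> b") (auto simp: mult.commute)
  qed
  obtain q where q: "prime q" "q dvd a"
    using ab prime_factor_nat[of a] by auto
  then have "q \<le> a" using ab by (auto intro: dvd_imp_le)
  then have "q * q \<le> a * b" using ab by (intro mult_mono) auto
  then show thesis using that[of q] q ab by (simp add: power2_eq_square)
qed

lemma Q_eq_div: "Q i j = nth_prime j div nth_prime i"
  by (simp add: Q_def floor_divide_of_nat_eq)

lemma Q'''_eq_div: "Q''' i j = ((nth_prime j)\<^sup>2 + 4 * nth_prime j + 2) div nth_prime i"
  unfolding Q'''_def floor_divide_of_nat_eq by simp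

text \<open>The interval starts above 1, the only positive number that is neither prime nor
  composite.\<close>

lemma S_set_eq_primes_in:
  "S_set j = primes_in {nth_prime j + 1 .. (nth_prime j)\<^sup>2 + 4 * nth_prime j + 3}"
  using prime_gt_0_nat[OF prime_nth_prime[of j]]
  by (auto simp: S_set_def primes_in_def composites_in_def)

lemma primes_in_endpoints:
  fixes p :: nat
  assumes "odd p" "p \<ge> 3"
  shows "primes_in {p + 1 .. p\<^sup>2 + 4 * p + 3} = primes_in {p + 2 .. p\<^sup>2 + 4 * p + 2}"
proof -
  have 1: "\<not> prime (p + 1)"
    using assms prime_odd_nat[of "p + 1"] by auto
  have "\<not> prime ((p + 1) * (p + 3))"
    using assms by (intro not_prime_mult_nat) auto
  also have "(p + 1) * (p + 3) = p\<^sup>2 + 4 * p + 3"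
    by (simp add: power2_eq_square algebra_simps)
  finally have 2: "\<not> prime (p\<^sup>2 + 4 * p + 3)" .
  have "n \<in> {p + 1 .. p\<^sup>2 + 4 * p + 3} \<longleftrightarrow> n \<in> {p + 2 .. p\<^sup>2 + 4 * p + 2}" if "prime n" for n
  proof -
    have "n \<noteq> p + 1" "n \<noteq> p\<^sup>2 + 4 * p + 3"
      using that 1 2 by blast+
    then show ?thesis by auto
  qed
  then show ?thesis
    unfolding primes_in_def by blast
qed

text \<open>The range of \<open>t\<close> consists of exactly those cofactors for which
  \<open>nth_prime i * t\<close> exceeds \<open>nth_prime j\<close> and stays within the upper end
  of the interval.\<close>

lemma mem_sieve_iff:
  assumes j: "j \<ge> 2"
    and n: "n \<in> {nth_prime j + 2 .. (nth_prime j)\<^sup>2 + 4 * nth_prime j + 2}"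
  shows "n \<in> (\<Union>i \<in> {1..j}. (\<lambda>t. nth_prime i * t) ` {Q i j + 1 .. Q''' i j}) \<longleftrightarrow> \<not> prime n"
    (is "_ \<in> ?U \<longleftrightarrow> _")
proof
  assume "n \<in> ?U"
  then obtain i t where it: "i \<le> j" "n = nth_prime i * t" by force
  have "1 < nth_prime i" by (intro prime_gt_1_nat prime_nth_prime)
  \<comment> \<open>A cofactor 0 or 1 would give
    \<open>n \<le> nth_prime i \<le> nth_prime j\<close>, below the interval.\<close>
  moreover have "1 < t"
  proof (rule ccontr)
    assume "\<not> 1 < t"
    then have "n \<le> nth_prime i" using it by (cases t) auto
    then show False using nth_prime_le_mono[OF it(1)] n by simp
  qed
  ultimately show "\<not> prime n" using it not_prime_mult_nat by simp
next
  let ?p = "nth_prime j"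
  assume "\<not> prime n"
  then obtain q where q: "prime q" "q dvd n" "q\<^sup>2 \<le> n"
    using composite_prime_factor_square_le[of n] n by auto
  have "n < (?p + 2)\<^sup>2" using n by (simp add: power2_eq_square algebra_simps)
  with q have "q < ?p + 2" by (meson le_less_trans power_less_imp_less_base zero_le)
  \<comment> \<open>\<open>?p + 1\<close> is even and at least 4; excluding it leaves
    \<open>q \<le> ?p\<close>, so \<open>q\<close> is among the first \<open>j\<close>
    primes.\<close>
  moreover have "q \<noteq> ?p + 1"
    using q prime_odd_nat[of q] prime_odd_nat[OF prime_nth_prime[of j]] nth_prime_ge_3[OF j]
    by auto
  ultimately obtain i where i: "i \<in> {1..j}" "q = nth_prime i"
    using prime_le_nth_primeE[of q j] q j by auto
  obtain t where t: "n = q * t" using q by blast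
  have "?p div q < t"
    using n t q by (intro less_mult_imp_div_less) (simp add: mult.commute)
  moreover have "t \<le> (?p\<^sup>2 + 4 * ?p + 2) div q"
    using n t q by (simp add: less_eq_div_iff_mult_less_eq prime_gt_0_nat mult.commute)
  ultimately have "t \<in> {Q i j + 1 .. Q''' i j}"
    by (simp add: Q_eq_div Q'''_eq_div i)
  with i t show "n \<in> ?U" by blast
qed

theorem theorem3p13:
  fixes j :: nat
  assumes "j \<ge> 2"
  shows "S_set j \<noteq> {}
    \<and> (\<exists>q \<in> S_set j. prime q)
    \<and> (S_set j = primes_in {nth_prime j + 1 .. (nth_prime j)\<^sup>2 + 4 * nth_prime j + 3}
       \<and> primes_in {nth_prime j + 1 .. (nth_prime j)\<^sup>2 + 4 * nth_prime j + 3}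
           = primes_in {nth_prime j + 2 .. (nth_prime j)\<^sup>2 + 4 * nth_prime j + 2})
    \<and> S_set j = {nth_prime j + 2 .. (nth_prime j)\<^sup>2 + 4 * nth_prime j + 2}
       - (\<Union>i \<in> {1..j}. (\<lambda>t. nth_prime i * t) ` {Q i j + 1 .. Q''' i j})"
proof -
  let ?p = "nth_prime j"
  have p: "?p \<ge> 3" "odd ?p"
    using nth_prime_ge_3[OF assms] prime_odd_nat[OF prime_nth_prime[of j]] by auto
  note endpoints = primes_in_endpoints[OF p(2,1)]
  obtain q where "prime q" "?p < q" "q \<le> ?p\<^sup>2 + 4 * ?p + 2"
    using exists_prime_between[of ?p] p by auto
  then have q: "q \<in> S_set j" "prime q"
    by (auto simp: S_set_eq_primes_in primes_in_def)
  \<comment> \<open>With the endpoints removed, both sides are subsets of the same interval, where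
    the sieve criterion decides membership.\<close>
  have "S_set j = {?p + 2 .. ?p\<^sup>2 + 4 * ?p + 2}
      - (\<Union>i \<in> {1..j}. (\<lambda>t. nth_prime i * t) ` {Q i j + 1 .. Q''' i j})"
    unfolding S_set_eq_primes_in endpoints
    using mem_sieve_iff[OF assms] unfolding primes_in_def by blast
  with q endpoints S_set_eq_primes_in show ?thesis by blast
qed

end
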